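(* Let $\mathcal{H}$ be a complex Hilbert space and let $T\in\mathcal{B}(\mathcal{H})$. Then for every $\lambda\in[0,1]$, $$\begin{aligned}\|M_\lambda(T)\|&\le2\int_0^1 r_\omega\left(\begin{bmatrix}0&\lambda tT+(1-\lambda)(1-t)T^D\\(1-\lambda)t(T^D)^*+\lambda(1-t)T^*&0\end{bmatrix}\right)dt\\&\le2\,r_\omega\left(\begin{bmatrix}0&\lambda T\\(1-\lambda)(T^D)^*&0\end{bmatrix}\right)\\&\le\sqrt{\big\|\lambda^2|T|^2+(1-\lambda)^2|T^D|^2\big\|+2\lambda(1-\lambda)\,r_\omega(T^*T^D)}\\&\le\lambda\|T\|+(1-\lambda)\|T^D\|.\end{aligned}$$
   Context: $\mathcal{B}(\mathcal{H})$ denotes the bounded linear operators on $\mathcal{H}$. $|S|=(S^*S)^{1/2}$, and $r_\omega(S)=\sup_{\|x\|=1}|\langle Sx,x\rangle|$ is the numerical radius. With $T=U|T|$ the canonical polar decomposition ($U$ a partial isometry with $\ker U=\ker T$), the Duggal transform is $T^D=|T|U$, and the $\lambda$-mean transform is $M_\lambda(T)=\lambda T+(1-\lambda)T^D$. The $2\times2$ operator matrices act on $\mathcal{H}\oplus\mathcal{H}$. *)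

theory Defs
  imports "HOL-Analysis.Analysis"
begin

text \<open>
  Complex inner product spaces extend the real inner product class of the library: the real
  structure (\<open>scaleR\<close>, \<open>inner\<close>, hence the norm) is the one underlying the complex structure.
  The form \<open>cinner\<close> is linear in the first argument. Its positive definiteness follows from that
  of \<open>inner\<close>, because \<open>cinner x x\<close> is real by \<open>cinner_commute\<close>.
\<close>

class complex_inner = real_inner +
  fixes scaleC :: "complex \<Rightarrow> 'a \<Rightarrow> 'a"  (infixr \<open>*\<^sub>C\<close> 75)
    and cinner :: "'a \<Rightarrow> 'a \<Rightarrow> complex"
  assumes scaleC_add_right: "c *\<^sub>C (x + y) = c *\<^sub>C x + c *\<^sub>C y"
    and scaleC_add_left: "(c + d) *\<^sub>C x = c *\<^sub>C x + d *\<^sub>C x"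
    and scaleC_scaleC: "c *\<^sub>C d *\<^sub>C x = (c * d) *\<^sub>C x"
    and scaleC_one: "1 *\<^sub>C x = x"
    and scaleR_scaleC: "r *\<^sub>R x = complex_of_real r *\<^sub>C x"
    and cinner_commute: "cinner x y = cnj (cinner y x)"
    and cinner_add_left: "cinner (x + y) z = cinner x z + cinner y z"
    and cinner_scaleC_left: "cinner (c *\<^sub>C x) y = c * cinner x y"
    and inner_eq_Re_cinner: "inner x y = Re (cinner x y)"

class chilbert_space = complex_inner + complete_space

instantiation complex :: chilbert_space
begin

definition scaleC_complex :: "complex \<Rightarrow> complex \<Rightarrow> complex"
  where "scaleC_complex c x = c * x"

definition cinner_complex :: "complex \<Rightarrow> complex \<Rightarrow> complex"
  where "cinner_complex x y = x * cnj y"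

instance
  by standard
    (simp_all add: scaleC_complex_def cinner_complex_def inner_complex_def algebra_simps
      scaleR_conv_of_real)

end

text \<open>The Hilbert direct sum; its norm is the Euclidean product norm of the library.\<close>

instantiation prod :: (complex_inner, complex_inner) complex_inner
begin

definition scaleC_prod :: "complex \<Rightarrow> 'a \<times> 'b \<Rightarrow> 'a \<times> 'b"
  where "scaleC_prod c p = (c *\<^sub>C fst p, c *\<^sub>C snd p)"

definition cinner_prod :: "'a \<times> 'b \<Rightarrow> 'a \<times> 'b \<Rightarrow> complex"
  where "cinner_prod p q = cinner (fst p) (fst q) + cinner (snd p) (snd q)"

instance
proof
  fix p q :: "'a \<times> 'b"
  show "cinner p q = cnj (cinner q p)"
    unfolding cinner_prod_def
    by (metis complex_cnj_add cinner_commute)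
qed (simp_all add: scaleC_prod_def cinner_prod_def inner_prod_def scaleC_add_right
      scaleC_add_left scaleC_scaleC scaleC_one scaleR_scaleC cinner_add_left
      cinner_scaleC_left inner_eq_Re_cinner algebra_simps prod_eq_iff)

end

instance prod :: (chilbert_space, chilbert_space) chilbert_space ..

text \<open>
  The type \<open>'a \<Rightarrow>\<^sub>L 'b\<close> consists of the bounded real-linear maps. The bounded operators of a
  complex space are its complex-homogeneous members; the operator norm is the same.
\<close>

definition clinear_op :: "('a::complex_inner \<Rightarrow>\<^sub>L 'b::complex_inner) \<Rightarrow> bool"
  where "clinear_op S \<longleftrightarrow> (\<forall>c x. blinfun_apply S (c *\<^sub>C x) = c *\<^sub>C blinfun_apply S x)"

definition cadjoint :: "('a::chilbert_space \<Rightarrow>\<^sub>L 'b::chilbert_space) \<Rightarrow> 'b \<Rightarrow>\<^sub>L 'a"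
  where "cadjoint S =
    (THE R. \<forall>x y. cinner (blinfun_apply S x) y = cinner x (blinfun_apply R y))"

definition positive_op :: "('a::complex_inner \<Rightarrow>\<^sub>L 'a) \<Rightarrow> bool"
  where "positive_op S \<longleftrightarrow>
    clinear_op S \<and> (\<forall>x. cinner (blinfun_apply S x) x \<in> \<real>\<^sub>\<ge>\<^sub>0)"

definition sqrt_op :: "('a::chilbert_space \<Rightarrow>\<^sub>L 'a) \<Rightarrow> 'a \<Rightarrow>\<^sub>L 'a"
  where "sqrt_op S = (THE R. positive_op R \<and> R o\<^sub>L R = S)"

definition abs_op :: "('a::chilbert_space \<Rightarrow>\<^sub>L 'b::chilbert_space) \<Rightarrow> 'a \<Rightarrow>\<^sub>L 'a"
  where "abs_op S = sqrt_op (cadjoint S o\<^sub>L S)"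

text \<open>
  On the zero space there are no unit vectors, and the supremum, taken in the nonnegative reals,
  is 0. In \<open>real\<close> the supremum of the empty set is unspecified, hence the case distinction.
\<close>

definition numerical_radius :: "('a::complex_inner \<Rightarrow>\<^sub>L 'a) \<Rightarrow> real"
  where "numerical_radius S =
    (if \<exists>x::'a. norm x = 1
     then SUP x\<in>{x. norm x = 1}. cmod (cinner (blinfun_apply S x) x) else 0)"

definition ker_op :: "('a::complex_inner \<Rightarrow>\<^sub>L 'b::complex_inner) \<Rightarrow> 'a set"
  where "ker_op S = {x. blinfun_apply S x = 0}"

definition partial_isometry :: "('a::complex_inner \<Rightarrow>\<^sub>L 'b::complex_inner) \<Rightarrow> bool"
  where "partial_isometry U \<longleftrightarrow> clinear_op U \<and>
    (\<forall>x. (\<forall>z\<in>ker_op U. cinner x z = 0) \<longrightarrow> norm (blinfun_apply U x) = norm x)"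

definition polar_factor :: "('a::chilbert_space \<Rightarrow>\<^sub>L 'b::chilbert_space) \<Rightarrow> 'a \<Rightarrow>\<^sub>L 'b"
  where "polar_factor S =
    (THE U. partial_isometry U \<and> ker_op U = ker_op S \<and> S = U o\<^sub>L abs_op S)"

definition duggal_transform :: "('a::chilbert_space \<Rightarrow>\<^sub>L 'a) \<Rightarrow> 'a \<Rightarrow>\<^sub>L 'a"
  where "duggal_transform S = abs_op S o\<^sub>L polar_factor S"

definition mean_transform :: "real \<Rightarrow> ('a::chilbert_space \<Rightarrow>\<^sub>L 'a) \<Rightarrow> 'a \<Rightarrow>\<^sub>L 'a"
  where "mean_transform l S = l *\<^sub>R S + (1 - l) *\<^sub>R duggal_transform S"

lift_definition op_matrix ::
  "('a::complex_inner \<Rightarrow>\<^sub>L 'a) \<Rightarrow> ('a \<Rightarrow>\<^sub>L 'a) \<Rightarrow> ('a \<Rightarrow>\<^sub>L 'a) \<Rightarrow> ('a \<Rightarrow>\<^sub>L 'a)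
    \<Rightarrow> ('a \<times> 'a) \<Rightarrow>\<^sub>L ('a \<times> 'a)"
  is "\<lambda>A B C D p. (A (fst p) + B (snd p), C (fst p) + D (snd p))"
  by (intro bounded_linear_Pair bounded_linear_add)
    (auto intro: bounded_linear_compose bounded_linear_fst bounded_linear_snd)

end

theory Submission imports Defs begin

text \<open>
  Put \<open>A = \<lambda>T\<close>, \<open>B = (1 - \<lambda>)T\<^sup>D\<close> and \<open>w(A, B)\<close> for the numerical radius of the block operator with
  off-diagonal entries \<open>A\<close> and \<open>B\<^sup>*\<close>. Its quadratic form at \<open>(x, y)\<close> is \<open>\<langle>Ay, x\<rangle> + cnj \<langle>By, x\<rangle>\<close>,
  which gives \<open>\<parallel>A + B\<parallel> \<le> 2 w(A, B)\<close>. The integrand is \<open>w(tA + (1 - t)B, tB + (1 - t)A)\<close>: the sum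
  of its arguments is \<open>A + B\<close>, and by convexity and symmetry of \<open>w\<close> it is at most \<open>w(A, B)\<close>. The
  remaining bounds follow by rotating the phase of the quadratic form and expanding
  \<open>\<parallel>cAy + cnj c By\<parallel>\<^sup>2\<close> for \<open>\<bar>c\<bar> = 1\<close>. Of \<open>T\<^sup>D\<close> only complex linearity is used; it rests on
  the existence and uniqueness of square roots and polar factors.
\<close>

\<comment> \<open>This makes the operators on a Hilbert space a complete normed space, in which the
  square root iteration converges.\<close>
subclass (in chilbert_space) banach ..

section \<open>Complex inner products\<close>

lemma cinner_add_right: "cinner x (y + z) = cinner x y + cinner x z"
  by (metis cinner_commute cinner_add_left complex_cnj_add)

lemma cinner_scaleC_right: "cinner x (c *\<^sub>C y) = cnj c * cinner x y"
  by (metis cinner_commute cinner_scaleC_left complex_cnj_mult)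

lemma cinner_scaleR_left: "cinner (r *\<^sub>R x) y = of_real r * cinner x y"
  by (simp add: scaleR_scaleC cinner_scaleC_left)

lemma cinner_scaleR_right: "cinner x (r *\<^sub>R y) = of_real r * cinner x y"
  by (simp add: scaleR_scaleC cinner_scaleC_right)

lemma cinner_zero_left [simp]: "cinner 0 x = 0"
  using cinner_scaleR_left[of 0 x x] by simp

lemma cinner_zero_right [simp]: "cinner x 0 = 0"
  using cinner_scaleR_right[of x 0 x] by simp

lemma cinner_self: "cinner x x = of_real ((norm x)\<^sup>2)"
proof (rule complex_eqI)
  show "Re (cinner x x) = Re (of_real ((norm x)\<^sup>2))"
    by (simp add: inner_eq_Re_cinner[symmetric] power2_norm_eq_inner)
  have "Im (cinner x x) = - Im (cinner x x)"
    using arg_cong[OF cinner_commute[of x x], of Im] by simp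
  then show "Im (cinner x x) = Im (of_real ((norm x)\<^sup>2))"
    by simp
qed

text \<open>The complex form is determined by the real one and multiplication by
  \<open>\<i>\<close>. Real identities thus extend to \<open>cinner\<close> as soon as the operators
  involved commute with \<open>\<i>\<close>.\<close>

lemma Im_cinner: "Im (cinner x y) = inner (- \<i> *\<^sub>C x) y"
  by (simp add: inner_eq_Re_cinner cinner_scaleC_left)

lemma norm_scaleC: "norm (c *\<^sub>C x) = cmod c * norm x"
proof -
  have "complex_of_real ((norm (c *\<^sub>C x))\<^sup>2) = c * cnj c * of_real ((norm x)\<^sup>2)"
    unfolding cinner_self[symmetric] by (simp add: cinner_scaleC_left cinner_scaleC_right)
  also have "\<dots> = complex_of_real ((cmod c * norm x)\<^sup>2)"
    by (simp add: complex_norm_square power_mult_distrib del: of_real_power)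
  finally have "(norm (c *\<^sub>C x))\<^sup>2 = (cmod c * norm x)\<^sup>2"
    using of_real_eq_iff by blast
  then show ?thesis
    by (simp add: power2_eq_iff_nonneg)
qed

lemma scaleC_scaleR: "c *\<^sub>C (r *\<^sub>R x) = r *\<^sub>R (c *\<^sub>C x)"
  by (simp add: scaleR_scaleC scaleC_scaleC mult.commute)

lemma scaleC_zero_right: "c *\<^sub>C 0 = 0"
  using scaleC_scaleR[of c 0 0] by simp

lemma scaleC_minus_left: "(- c) *\<^sub>C x = - (c *\<^sub>C x)"
  using scaleC_scaleC[of "-1" c x] scaleR_scaleC[of "-1" "c *\<^sub>C x"] by simp

lemma scaleC_minus_right: "c *\<^sub>C (- x) = - (c *\<^sub>C x)"
  using scaleC_scaleR[of c "-1" x] by simp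

lemma scaleC_diff_right: "c *\<^sub>C (x - y) = c *\<^sub>C x - c *\<^sub>C y"
  by (metis diff_conv_add_uminus scaleC_add_right scaleC_minus_right)

lemma bounded_linear_scaleC: "bounded_linear (\<lambda>x. c *\<^sub>C x)"
  by (rule bounded_linear_intro[where K = "cmod c"])
    (simp_all add: scaleC_add_right scaleC_scaleR norm_scaleC mult.commute)

lemmas continuous_on_scaleC [continuous_intros] =
  bounded_linear.continuous_on[OF bounded_linear_scaleC]

lemma ex_unit_mult_eq_cmod: "\<exists>c. cmod c = 1 \<and> c * z = of_real (cmod z)"
proof (cases "z = 0")
  case True
  then show ?thesis
    by (intro exI[of _ 1]) simp
next
  case False
  then show ?thesis
    by (intro exI[of _ "of_real (cmod z) / z"]) (simp add: norm_divide)
qed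

text \<open>Rotating the phase of \<open>x\<close> makes the form real and nonnegative, so the real
  Cauchy-Schwarz inequality applies.\<close>

lemma norm_cinner_le: "cmod (cinner x y) \<le> norm x * norm y"
proof -
  obtain c where c: "cmod c = 1" "c * cinner x y = of_real (cmod (cinner x y))"
    using ex_unit_mult_eq_cmod by blast
  have "cmod (cinner x y) = inner (c *\<^sub>C x) y"
    by (simp add: inner_eq_Re_cinner cinner_scaleC_left c)
  also have "\<dots> \<le> norm (c *\<^sub>C x) * norm y"
    by (rule norm_cauchy_schwarz)
  finally show ?thesis
    by (simp add: norm_scaleC c)
qed

lemma cinner_ext: "(\<And>z. cinner z x = cinner z y) \<Longrightarrow> x = y"
  by (rule vector_eq_ldot[THEN iffD1]) (simp add: inner_eq_Re_cinner)

section \<open>Complex-linear operators\<close>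

lemma clinear_opD: "clinear_op S \<Longrightarrow> blinfun_apply S (c *\<^sub>C x) = c *\<^sub>C blinfun_apply S x"
  by (simp add: clinear_op_def)

text \<open>Split \<open>c\<close> into real and imaginary part; real linearity is built into the
  type. Commutation with the single scalar \<open>\<i>\<close> is a condition that survives limits
  and closures.\<close>

lemma clinear_opI:
  assumes "\<And>x. blinfun_apply S (\<i> *\<^sub>C x) = \<i> *\<^sub>C blinfun_apply S x"
  shows "clinear_op S"
proof -
  have decomp: "c *\<^sub>C y = Re c *\<^sub>R y + Im c *\<^sub>R (\<i> *\<^sub>C y)" for c and y :: "'z::complex_inner"
    by (simp add: scaleR_scaleC scaleC_scaleC flip: scaleC_add_left)
      (simp add: mult.commute flip: complex_eq)
  show ?thesis
    unfolding clinear_op_def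
    by (subst (1 2) decomp) (simp add: blinfun.bilinear_simps assms)
qed

lemma clinear_op_add: "clinear_op S \<Longrightarrow> clinear_op R \<Longrightarrow> clinear_op (S + R)"
  by (simp add: clinear_op_def blinfun.bilinear_simps scaleC_add_right)

lemma clinear_op_scaleR: "clinear_op S \<Longrightarrow> clinear_op (r *\<^sub>R S)"
  by (simp add: clinear_op_def blinfun.bilinear_simps scaleC_scaleR)

lemma clinear_op_compose: "clinear_op S \<Longrightarrow> clinear_op R \<Longrightarrow> clinear_op (S o\<^sub>L R)"
  by (simp add: clinear_op_def)

section \<open>Orthogonal projection and adjoints\<close>

text \<open>Near 0 the linear term dominates the quadratic one. This first-variation principle
  serves both the nearest-point projection and \<open>positive_op_eq_zero\<close>.\<close>

lemma linear_coeff_zero_if_quadratic_nonneg: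
  fixes a b :: real
  assumes "\<And>t. 0 \<le> 2 * t * a + t\<^sup>2 * b"
  shows "a = 0"
proof (rule ccontr)
  assume a: "a \<noteq> 0"
  \<comment> \<open>Adding 1 keeps \<open>B\<close> positive and strictly above \<open>b\<close>,
    whatever the sign of \<open>b\<close>; at \<open>t = - a / B\<close> the quadratic then falls
    below \<open>- (a\<^sup>2 / B)\<close>.\<close>
  define B where "B = \<bar>b\<bar> + 1"
  have B: "B > 0" "b < B"
    by (auto simp: B_def)
  have "0 \<le> 2 * (- a / B) * a + (- a / B)\<^sup>2 * b"
    by (rule assms)
  also have "\<dots> < 2 * (- a / B) * a + (- a / B)\<^sup>2 * B"
    using a B by (intro add_strict_left_mono mult_strict_left_mono) auto
  also have "\<dots> = - (a\<^sup>2 / B)"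
    using B by (simp add: field_simps power2_eq_square)
  finally show False
    using B a by (simp add: field_simps)
qed

text \<open>A minimising sequence for the distance to \<open>K\<close> is Cauchy, its limit
  \<open>p\<close> is a nearest point, and vanishing of the first variation at \<open>p\<close> is
  orthogonality.\<close>

lemma ex_orthogonal_projection:
  fixes x :: "'a::{real_inner, complete_space}"
  assumes K: "subspace K" "closed K"
  shows "\<exists>p\<in>K. \<forall>k\<in>K. inner (x - p) k = 0"
proof -
  define \<delta> where "\<delta> = (INF k\<in>K. (norm (x - k))\<^sup>2)"
  have K0: "0 \<in> K"
    using K(1) by (rule subspace_0)
  have bdd: "bdd_below ((\<lambda>k. (norm (x - k))\<^sup>2) ` K)"
    by (rule bdd_belowI[of _ 0]) auto
  have \<delta>_le: "\<delta> \<le> (norm (x - k))\<^sup>2" if "k \<in> K" for k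
    unfolding \<delta>_def using bdd that by (rule cINF_lower)
  have "\<exists>k\<in>K. (norm (x - k))\<^sup>2 < \<delta> + inverse (Suc n)" for n
    using cINF_less_iff[OF _ bdd, of "\<delta> + inverse (Suc n)"] K0
    by (auto simp: \<delta>_def)
  then obtain a where a: "\<And>n. a n \<in> K" "\<And>n. (norm (x - a n))\<^sup>2 < \<delta> + inverse (Suc n)"
    by metis
  \<comment> \<open>Parallelogram identity: the midpoint lies in \<open>K\<close>, so its squared
    distance to \<open>x\<close> is at least \<open>\<delta>\<close>, and the excesses of
    \<open>a m\<close> and \<open>a n\<close> over \<open>\<delta>\<close> control the gap.\<close>
  have near: "(norm (a m - a n))\<^sup>2 \<le> 2 * inverse (Suc m) + 2 * inverse (Suc n)" for m n
  proof -
    have mid: "(1/2) *\<^sub>R (a m + a n) \<in> K"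
      using K(1) a(1) by (intro subspace_scale subspace_add)
    have "(norm (a m - a n))\<^sup>2 + 4 * (norm (x - (1/2) *\<^sub>R (a m + a n)))\<^sup>2
        = 2 * (norm (x - a m))\<^sup>2 + 2 * (norm (x - a n))\<^sup>2"
      by (simp add: power2_norm_eq_inner algebra_simps inner_commute)
    then show ?thesis
      using a(2)[of m] a(2)[of n] \<delta>_le[OF mid] by linarith
  qed
  have "Cauchy a"
  proof (rule metric_CauchyI)
    fix e :: real
    assume "0 < e"
    \<comment> \<open>Beyond \<open>N\<close> the bound in \<open>near\<close> is at most four times
      \<open>inverse (Suc N)\<close>, hence the quarter.\<close>
    then obtain N where N: "inverse (real (Suc N)) < e\<^sup>2 / 4"
      using reals_Archimedean[of "e\<^sup>2 / 4"] by auto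
    have "dist (a m) (a n) < e" if "m \<ge> N" "n \<ge> N" for m n
    proof -
      have "inverse (real (Suc m)) \<le> inverse (real (Suc N))"
        "inverse (real (Suc n)) \<le> inverse (real (Suc N))"
        using that by (auto intro!: le_imp_inverse_le)
      then have "(norm (a m - a n))\<^sup>2 < e\<^sup>2"
        using near[of m n] N by linarith
      then show ?thesis
        using \<open>0 < e\<close> by (simp add: dist_norm power2_less_imp_less)
    qed
    then show "\<exists>M. \<forall>m\<ge>M. \<forall>n\<ge>M. dist (a m) (a n) < e"
      by blast
  qed
  then obtain p where p: "a \<longlonglongrightarrow> p"
    by (meson Cauchy_convergent convergent_def)
  then have pK: "p \<in> K"
    using K(2) a(1) closed_sequentially by blast
  have "(norm (x - p))\<^sup>2 \<le> \<delta> + 0"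
  proof (rule LIMSEQ_le)
    show "(\<lambda>n. (norm (x - a n))\<^sup>2) \<longlonglongrightarrow> (norm (x - p))\<^sup>2"
      by (intro tendsto_intros p)
    show "(\<lambda>n. \<delta> + inverse (real (Suc n))) \<longlonglongrightarrow> \<delta> + 0"
      by (intro tendsto_intros LIMSEQ_inverse_real_of_nat)
  qed (use a(2) less_imp_le in blast)
  have "inner (x - p) k = 0" if k: "k \<in> K" for k
  proof -
    \<comment> \<open>The sign is that of the linear coefficient of \<open>t\<close> in the squared
      distance from \<open>x\<close> to \<open>p + t *\<^sub>R k\<close>.\<close>
    have "- inner (x - p) k = 0"
    proof (rule linear_coeff_zero_if_quadratic_nonneg)
      fix t :: real
      have "p + t *\<^sub>R k \<in> K"
        using K(1) pK k by (intro subspace_add subspace_scale)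
      then have "(norm (x - p))\<^sup>2 \<le> (norm (x - (p + t *\<^sub>R k)))\<^sup>2"
        using \<delta>_le[of "p + t *\<^sub>R k"] \<open>(norm (x - p))\<^sup>2 \<le> \<delta> + 0\<close> by linarith
      then have "0 \<le> (norm (x - (p + t *\<^sub>R k)))\<^sup>2 - (norm (x - p))\<^sup>2"
        by simp
      then show "0 \<le> 2 * t * - inner (x - p) k + t\<^sup>2 * inner k k"
        unfolding power2_norm_eq_inner
        by (simp add: algebra_simps inner_commute power2_eq_square)
    qed
    then show ?thesis
      by simp
  qed
  then show ?thesis
    using pK by blast
qed

text \<open>The residual \<open>q\<close> of a vector outside the kernel is orthogonal to the
  kernel, and every \<open>x\<close> differs from a multiple of \<open>q\<close> by a kernel
  element.\<close>

lemma Riesz_representation: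
  fixes f :: "'a::{real_inner, complete_space} \<Rightarrow> real"
  assumes f: "bounded_linear f"
  shows "\<exists>z. \<forall>x. f x = inner x z"
proof (cases "\<forall>x. f x = 0")
  case True
  then show ?thesis
    by (intro exI[of _ 0]) simp
next
  case False
  then obtain x0 where x0: "f x0 \<noteq> 0"
    by blast
  interpret f: bounded_linear f
    by (fact f)
  define K where "K = {x. f x = 0}"
  have "subspace K"
    by (auto simp: K_def subspace_def f.add f.scaleR f.zero)
  moreover have "closed K"
    unfolding K_def by (intro closed_Collect_eq continuous_intros f.continuous_on)
  ultimately obtain p where p: "p \<in> K" "\<And>k. k \<in> K \<Longrightarrow> inner (x0 - p) k = 0"
    using ex_orthogonal_projection by metis
  define q where "q = x0 - p"
  have fq: "f q \<noteq> 0"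
    using p(1) x0 by (simp add: q_def K_def f.diff)
  then have q: "q \<noteq> 0"
    using f.zero by auto
  have "f x = inner x ((f q / inner q q) *\<^sub>R q)" for x
  proof -
    have "x - (f x / f q) *\<^sub>R q \<in> K"
      using fq by (simp add: K_def f.diff f.scaleR)
    then have "inner q (x - (f x / f q) *\<^sub>R q) = 0"
      using p(2) unfolding q_def by blast
    then have "inner q x = f x / f q * inner q q"
      by (simp add: inner_diff_right)
    then show ?thesis
      using fq q by (simp add: inner_commute)
  qed
  then show ?thesis
    by blast
qed

section \<open>Adjoint operators\<close>

lemma ex_cadjoint:
  fixes S :: "'a::chilbert_space \<Rightarrow>\<^sub>L 'b::chilbert_space"
  assumes S: "clinear_op S"
  shows "\<exists>R. \<forall>x y. cinner (blinfun_apply S x) y = cinner x (blinfun_apply R y)"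
proof -
  have "\<exists>z. \<forall>x. inner (blinfun_apply S x) y = inner x z" for y
    by (intro Riesz_representation bounded_linear_intros)
  then obtain g where g: "\<And>x y. inner (blinfun_apply S x) y = inner x (g y)"
    by metis
  have "bounded_linear g"
  proof (rule bounded_linear_intro[where K = "norm S"])
    show "g (x + y) = g x + g y" for x y
      by (rule vector_eq_ldot[THEN iffD1]) (simp add: inner_add_right flip: g)
    show "g (r *\<^sub>R x) = r *\<^sub>R g x" for r x
      by (rule vector_eq_ldot[THEN iffD1]) (simp flip: g)
    show "norm (g x) \<le> norm x * norm S" for x
    proof (cases "g x = 0")
      case False
      have "norm (g x) * norm (g x) = inner (blinfun_apply S (g x)) x"
        by (simp add: g power2_norm_eq_inner[symmetric] power2_eq_square)
      also have "\<dots> \<le> norm (blinfun_apply S (g x)) * norm x"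
        by (rule norm_cauchy_schwarz)
      also have "\<dots> \<le> norm (g x) * (norm x * norm S)"
        using mult_right_mono[OF norm_blinfun[of S "g x"] norm_ge_zero[of x]]
        by (simp add: ac_simps)
      finally show ?thesis
        using False by simp
    qed simp
  qed
  then have "blinfun_apply (Blinfun g) = g"
    by (rule bounded_linear_Blinfun_apply)
  \<comment> \<open>So far \<open>g\<close> is only the real adjoint. The imaginary part is the real
    form at \<open>- \<i> *\<^sub>C x\<close>, and complex linearity of \<open>S\<close> moves that
    scalar across.\<close>
  moreover have "cinner (blinfun_apply S x) y = cinner x (g y)" for x y
    by (rule complex_eqI)
      (simp_all add: inner_eq_Re_cinner[symmetric] Im_cinner g clinear_opD[OF S, symmetric])
  ultimately show ?thesis
    by (intro exI[of _ "Blinfun g"]) simp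
qed

lemma cinner_cadjoint_right:
  assumes "clinear_op S"
  shows "cinner (blinfun_apply S x) y = cinner x (blinfun_apply (cadjoint S) y)"
proof -
  have "\<exists>!R. \<forall>x y. cinner (blinfun_apply S x) y = cinner x (blinfun_apply R y)"
  proof (rule ex_ex1I)
    show "\<exists>R. \<forall>x y. cinner (blinfun_apply S x) y = cinner x (blinfun_apply R y)"
      using assms by (rule ex_cadjoint)
  next
    fix R R'
    assume "\<forall>x y. cinner (blinfun_apply S x) y = cinner x (blinfun_apply R y)"
      and "\<forall>x y. cinner (blinfun_apply S x) y = cinner x (blinfun_apply R' y)"
    then show "R = R'"
      by (metis blinfun_eqI cinner_ext)
  qed
  then have "\<forall>x y. cinner (blinfun_apply S x) y = cinner x (blinfun_apply (cadjoint S) y)"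
    unfolding cadjoint_def by (rule theI')
  then show ?thesis
    by blast
qed

lemma cinner_cadjoint_left:
  assumes "clinear_op S"
  shows "cinner (blinfun_apply (cadjoint S) x) y = cinner x (blinfun_apply S y)"
  by (metis assms cinner_cadjoint_right cinner_commute)

lemma inner_cadjoint_left:
  assumes "clinear_op S"
  shows "inner (blinfun_apply (cadjoint S) x) y = inner x (blinfun_apply S y)"
  by (simp add: inner_eq_Re_cinner cinner_cadjoint_left[OF assms])

lemma inner_cadjoint_right:
  assumes "clinear_op S"
  shows "inner x (blinfun_apply (cadjoint S) y) = inner (blinfun_apply S x) y"
  by (simp add: inner_eq_Re_cinner cinner_cadjoint_right[OF assms])

lemma clinear_op_cadjoint:
  assumes "clinear_op S"
  shows "clinear_op (cadjoint S)"
  unfolding clinear_op_def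
  by (intro allI, rule cinner_ext)
    (simp add: cinner_cadjoint_right[OF assms, symmetric] cinner_scaleC_right)

lemma norm_cadjoint_le:
  assumes "clinear_op S"
  shows "norm (cadjoint S) \<le> norm S"
proof (rule norm_blinfun_bound)
  fix y
  let ?z = "blinfun_apply (cadjoint S) y"
  have "(norm ?z)\<^sup>2 = inner y (blinfun_apply S ?z)"
    by (simp add: power2_norm_eq_inner inner_cadjoint_left[OF assms])
  also have "\<dots> \<le> norm y * norm (blinfun_apply S ?z)"
    by (rule norm_cauchy_schwarz)
  also have "\<dots> \<le> norm y * (norm S * norm ?z)"
    by (intro mult_left_mono norm_blinfun norm_ge_zero)
  finally have "norm ?z * norm ?z \<le> (norm S * norm y) * norm ?z"
    by (simp add: power2_eq_square ac_simps)
  then show "norm ?z \<le> norm S * norm y"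
    by (cases "?z = 0") simp_all
qed simp

lemma norm_cadjoint_compose_le:
  assumes "clinear_op S"
  shows "norm (cadjoint S o\<^sub>L R) \<le> norm S * norm R"
  by (rule order_trans[OF norm_blinfun_compose])
    (intro mult_right_mono norm_cadjoint_le assms norm_ge_zero)

lemma cadjoint_unique:
  assumes "clinear_op S" and "\<And>x y. cinner (blinfun_apply S x) y = cinner x (blinfun_apply R y)"
  shows "cadjoint S = R"
  using assms cinner_cadjoint_right[OF assms(1)] by (metis blinfun_eqI cinner_ext)

lemma cadjoint_add:
  assumes "clinear_op S" "clinear_op R"
  shows "cadjoint (S + R) = cadjoint S + cadjoint R"
  using assms
  by (intro cadjoint_unique clinear_op_add)
    (simp_all add: blinfun.add_left cinner_add_left cinner_add_right cinner_cadjoint_right)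

lemma cadjoint_scaleR:
  assumes "clinear_op S"
  shows "cadjoint (r *\<^sub>R S) = r *\<^sub>R cadjoint S"
  using assms
  by (intro cadjoint_unique clinear_op_scaleR)
    (simp_all add: blinfun.scaleR_left cinner_scaleR_left cinner_scaleR_right cinner_cadjoint_right)

section \<open>Square roots\<close>

text \<open>With \<open>B = 1 - R\<close> the equation \<open>R\<^sup>2 = 1 - A\<close> becomes the fixed point equation
  \<open>B = (A + B\<^sup>2) / 2\<close>. Its iteration from 0 is majorised by the scalar iteration
  \<open>r \<mapsto> (1 + r\<^sup>2) / 2\<close>, which increases to 1. Properties of \<open>B\<close> are read off from closed sets
  preserved by the iteration.\<close>

lemma ex_fixed_point_sqrt_iteration:
  fixes A :: "'a::banach \<Rightarrow>\<^sub>L 'a"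
  assumes A: "norm A \<le> 1"
  shows "\<exists>B. B = (1/2) *\<^sub>R (A + (B o\<^sub>L B)) \<and> norm B \<le> 1 \<and>
    (\<forall>Q. closed Q \<longrightarrow> 0 \<in> Q \<longrightarrow> (\<forall>X\<in>Q. (1/2) *\<^sub>R (A + (X o\<^sub>L X)) \<in> Q) \<longrightarrow> B \<in> Q)"
proof -
  define F where "F = (\<lambda>X. (1/2) *\<^sub>R (A + (X o\<^sub>L X)))"
  define f where "f = (\<lambda>x::real. (1 + x\<^sup>2) / 2)"
  define a where "a n = (F ^^ n) 0" for n
  define r where "r n = (f ^^ n) 0" for n
  have a_0: "a 0 = 0" and a_Suc: "a (Suc n) = F (a n)" and r_Suc: "r (Suc n) = f (r n)" for n
    by (simp_all add: a_def r_def)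
  have a_le: "norm (a n) \<le> r n \<and> 0 \<le> r n \<and> r n \<le> 1" for n
  proof (induction n)
    case 0
    show ?case
      by (simp add: a_def r_def)
  next
    case (Suc n)
    have "norm (a n o\<^sub>L a n) \<le> norm (a n) * norm (a n)"
      by (rule norm_blinfun_compose)
    also have "\<dots> \<le> r n * r n"
      using Suc by (intro mult_mono) auto
    finally have "norm (F (a n)) \<le> f (r n)"
      using norm_triangle_ineq[of A "a n o\<^sub>L a n"] A
      by (simp add: F_def f_def power2_eq_square)
    moreover have "0 \<le> f (r n)" "f (r n) \<le> 1"
      using Suc by (simp_all add: f_def power_le_one)
    ultimately show ?case
      by (simp add: a_Suc r_Suc)
  qed
  have step: "norm (a (Suc n) - a n) \<le> r (Suc n) - r n" for n
  proof (induction n)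
    case 0
    show ?case
      using A by (simp add: a_def r_def F_def f_def)
  next
    case (Suc n)
    let ?X = "a (Suc n)" and ?Y = "a n" and ?x = "r (Suc n)" and ?y = "r n"
    \<comment> \<open>A difference of squares with the operator factors kept in order; the norm
      bounds of its two terms add up to the scalar difference of squares.\<close>
    have "(?X o\<^sub>L ?X) - (?Y o\<^sub>L ?Y) = (?X o\<^sub>L (?X - ?Y)) + ((?X - ?Y) o\<^sub>L ?Y)"
      by (rule blinfun_eqI) (simp add: blinfun.bilinear_simps)
    also have "norm \<dots> \<le> norm ?X * norm (?X - ?Y) + norm (?X - ?Y) * norm ?Y"
      by (intro norm_triangle_le add_mono norm_blinfun_compose)
    also have "\<dots> \<le> ?x * (?x - ?y) + (?x - ?y) * ?y"
      using Suc a_le[of n] a_le[of "Suc n"] order_trans[OF norm_ge_zero Suc]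
      by (intro add_mono mult_mono) auto
    finally have "norm ((?X o\<^sub>L ?X) - (?Y o\<^sub>L ?Y)) \<le> ?x\<^sup>2 - ?y\<^sup>2"
      by (simp add: power2_eq_square algebra_simps)
    moreover have "F ?X - F ?Y = (1/2) *\<^sub>R ((?X o\<^sub>L ?X) - (?Y o\<^sub>L ?Y))"
      by (simp add: F_def algebra_simps)
    moreover have "f ?x - f ?y = (?x\<^sup>2 - ?y\<^sup>2) / 2"
      by (simp add: f_def field_simps)
    ultimately have "norm (F ?X - F ?Y) \<le> f ?x - f ?y"
      by simp
    then show ?case
      by (simp add: a_Suc r_Suc)
  qed
  \<comment> \<open>The scalar increments telescope, so convergence of the bounded monotone
    \<open>r\<close> makes them summable. By \<open>step\<close> they dominate the operator
    increments, and completeness gives the limit.\<close>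
  have "incseq r"
    by (rule incseq_SucI) (meson step diff_ge_0_iff_ge norm_ge_zero order_trans)
  then have "convergent r"
    using a_le by (meson incseq_convergent convergentI)
  then have "summable (\<lambda>n. r (Suc n) - r n)"
    using telescope_summable convergent_LIMSEQ_iff by blast
  then have "summable (\<lambda>n. a (Suc n) - a n)"
    by (rule summable_comparison_test'[where N = 0]) (rule step)
  then have "convergent (\<lambda>n. \<Sum>k<n. a (Suc k) - a k)"
    by (simp add: summable_iff_convergent)
  then have "convergent a"
    by (simp add: sum_lessThan_telescope a_0)
  then obtain B where B: "a \<longlonglongrightarrow> B"
    by (auto simp: convergent_def)
  have "(\<lambda>n. F (a n)) \<longlonglongrightarrow> F B"
    unfolding F_def by (intro tendsto_intros B)
  then have "B = F B"
    using LIMSEQ_unique LIMSEQ_Suc[OF B] by (simp add: a_Suc)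
  moreover have "norm B \<le> 1"
    using a_le by (intro LIMSEQ_le_const2[OF tendsto_norm[OF B]]) (meson order_trans)
  moreover have "B \<in> Q" if Q: "closed Q" "0 \<in> Q" "\<forall>X\<in>Q. F X \<in> Q" for Q
  proof -
    have "a n \<in> Q" for n
      by (induction n) (use Q in \<open>simp_all add: a_0 a_Suc\<close>)
    then show ?thesis
      using Q(1) B closed_sequentially by blast
  qed
  ultimately show ?thesis
    unfolding F_def by blast
qed

section \<open>Positive operators\<close>

lemma positive_op_symmetric:
  assumes P: "positive_op P"
  shows "cinner (blinfun_apply P x) y = cinner x (blinfun_apply P y)"
proof -
  have real: "Im (cinner (blinfun_apply P x) x) = 0" for x
    using P by (auto simp: positive_op_def complex_nonneg_Reals_iff)
  \<comment> \<open>Polarisation: reality of the quadratic form at \<open>x + y\<close> gives this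
    relation for imaginary parts, and replacing \<open>x\<close> by \<open>\<i> *\<^sub>C x\<close>
    then gives the one for real parts.\<close>
  have sum0: "Im (cinner (blinfun_apply P x) y) = - Im (cinner (blinfun_apply P y) x)" for x y
    using real[of "x + y"] real[of x] real[of y]
    by (simp add: blinfun.bilinear_simps cinner_add_left cinner_add_right)
  have "Re (cinner (blinfun_apply P x) y) = Re (cinner (blinfun_apply P y) x)"
    using sum0[of "\<i> *\<^sub>C x" y] P
    by (simp add: positive_op_def clinear_opD cinner_scaleC_left cinner_scaleC_right)
  moreover have "cinner x (blinfun_apply P y) = cnj (cinner (blinfun_apply P y) x)"
    by (rule cinner_commute)
  ultimately show ?thesis
    using sum0[of x y] by (intro complex_eqI) simp_all
qed

lemma positive_op_inner_nonneg: "positive_op P \<Longrightarrow> 0 \<le> inner (blinfun_apply P x) x"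
  by (simp add: positive_op_def inner_eq_Re_cinner complex_nonneg_Reals_iff)

lemma positive_op_inner_symmetric:
  "positive_op P \<Longrightarrow> inner (blinfun_apply P x) y = inner x (blinfun_apply P y)"
  by (simp add: inner_eq_Re_cinner positive_op_symmetric)

text \<open>Symmetry for the real form, combined with complex linearity, equates the imaginary part
  of the quadratic form with its own negative.\<close>

lemma positive_opI:
  assumes "clinear_op P"
    and sym: "\<And>x y. inner (blinfun_apply P x) y = inner x (blinfun_apply P y)"
    and "\<And>x. 0 \<le> inner (blinfun_apply P x) x"
  shows "positive_op P"
proof -
  have "Im (cinner (blinfun_apply P x) x) = 0" for x
  proof -
    have "inner (- \<i> *\<^sub>C blinfun_apply P x) x = inner (blinfun_apply P (- \<i> *\<^sub>C x)) x"
      using assms(1) by (simp add: clinear_opD)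
    also have "\<dots> = Im (cinner x (blinfun_apply P x))"
      by (simp add: sym Im_cinner)
    also have "\<dots> = - Im (cinner (blinfun_apply P x) x)"
      by (subst cinner_commute) simp
    finally show ?thesis
      by (simp add: Im_cinner)
  qed
  then show ?thesis
    using assms by (simp add: positive_op_def complex_nonneg_Reals_iff inner_eq_Re_cinner)
qed

text \<open>Varying \<open>x\<close> in the direction \<open>P x\<close> gives a nonnegative
  quadratic in \<open>t\<close> with zero constant term, whose linear coefficient is twice the
  squared norm of \<open>P x\<close>.\<close>

lemma positive_op_eq_zero:
  assumes P: "positive_op P" and x: "inner (blinfun_apply P x) x = 0"
  shows "blinfun_apply P x = 0"
proof -
  let ?z = "blinfun_apply P x"
  have "inner ?z ?z = 0"
  proof (rule linear_coeff_zero_if_quadratic_nonneg)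
    fix t :: real
    have "0 \<le> inner (blinfun_apply P (x + t *\<^sub>R ?z)) (x + t *\<^sub>R ?z)"
      using P by (rule positive_op_inner_nonneg)
    also have "\<dots> = 2 * t * inner ?z ?z + t\<^sup>2 * inner (blinfun_apply P ?z) ?z"
      using positive_op_inner_symmetric[OF P, of ?z x]
      by (simp add: blinfun.bilinear_simps inner_add_left inner_add_right x power2_eq_square
          algebra_simps)
    finally show "0 \<le> 2 * t * inner ?z ?z + t\<^sup>2 * inner (blinfun_apply P ?z) ?z" .
  qed
  then show ?thesis
    by simp
qed

text \<open>Commutation gives \<open>(P + Q)(P - Q) = 0\<close>. For \<open>y = (P - Q) x\<close>
  the forms of \<open>P\<close> and \<open>Q\<close> at \<open>y\<close> are nonnegative with sum 0,
  so both operators kill \<open>y\<close>, and \<open>y\<close> is orthogonal to itself.\<close>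

lemma positive_sqrt_unique:
  assumes P: "positive_op P" and Q: "positive_op Q"
    and sq: "P o\<^sub>L P = Q o\<^sub>L Q" and comm: "P o\<^sub>L Q = Q o\<^sub>L P"
  shows "P = Q"
proof (rule blinfun_eqI)
  fix x
  let ?D = "\<lambda>v. blinfun_apply P v - blinfun_apply Q v"
  have sq': "blinfun_apply P (blinfun_apply P v) = blinfun_apply Q (blinfun_apply Q v)"
    and comm': "blinfun_apply P (blinfun_apply Q v) = blinfun_apply Q (blinfun_apply P v)" for v
    using sq comm by (metis blinfun_apply_blinfun_compose)+
  let ?y = "?D x"
  have "blinfun_apply P ?y + blinfun_apply Q ?y = 0"
    by (simp add: blinfun.bilinear_simps sq' comm')
  then have "inner (blinfun_apply P ?y) ?y + inner (blinfun_apply Q ?y) ?y = 0"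
    by (simp flip: inner_add_left)
  then have "inner (blinfun_apply P ?y) ?y = 0" "inner (blinfun_apply Q ?y) ?y = 0"
    using positive_op_inner_nonneg[OF P, of ?y] positive_op_inner_nonneg[OF Q, of ?y] by linarith+
  then have "blinfun_apply P ?y = 0" "blinfun_apply Q ?y = 0"
    using P Q positive_op_eq_zero by blast+
  then have "inner x (?D ?y) = 0"
    by simp
  moreover have "inner x (?D ?y) = inner ?y ?y"
    by (simp only: inner_diff_right[of x] inner_diff_left[of _ _ ?y]
        positive_op_inner_symmetric[OF P] positive_op_inner_symmetric[OF Q])
  ultimately show "blinfun_apply P x = blinfun_apply Q x"
    by simp
qed

text \<open>The iteration is applied to \<open>1 - G / c\<close>, and the root is
  \<open>sqrt c\<close> times \<open>1 - B\<close>. The commutation clause is what makes uniqueness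
  applicable to an arbitrary second root.\<close>

lemma ex_positive_sqrt:
  fixes S :: "'a::chilbert_space \<Rightarrow>\<^sub>L 'b::chilbert_space"
  assumes S: "clinear_op S"
  shows "\<exists>P. positive_op P \<and> P o\<^sub>L P = cadjoint S o\<^sub>L S \<and>
    (\<forall>C. C o\<^sub>L (cadjoint S o\<^sub>L S) = (cadjoint S o\<^sub>L S) o\<^sub>L C \<longrightarrow> C o\<^sub>L P = P o\<^sub>L C)"
proof -
  define G where "G = cadjoint S o\<^sub>L S"
  \<comment> \<open>The squared norm of \<open>S\<close> brings \<open>A\<close> into the unit ball;
    the added 1 keeps \<open>c\<close> positive when \<open>S\<close> is 0.\<close>
  define c where "c = (norm S)\<^sup>2 + 1"
  define A where "A = id_blinfun - (1 / c) *\<^sub>R G"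
  have c: "c > 0"
    by (simp add: c_def add_nonneg_pos)
  have G_lin: "clinear_op G"
    unfolding G_def by (intro clinear_op_compose clinear_op_cadjoint S)
  have inner_G: "inner (blinfun_apply G x) y = inner (blinfun_apply S x) (blinfun_apply S y)"
    "inner x (blinfun_apply G y) = inner (blinfun_apply S x) (blinfun_apply S y)" for x y
    by (simp_all add: G_def inner_cadjoint_left[OF S] inner_cadjoint_right[OF S])
  have A_apply: "blinfun_apply A x = x - (1 / c) *\<^sub>R blinfun_apply G x" for x
    by (simp add: A_def blinfun.bilinear_simps)
  \<comment> \<open>In the expansion of the squared norm of \<open>A x\<close>, one of the two
    copies of \<open>inner (G x) x / c\<close> absorbs the quadratic term and the other only
    decreases the value.\<close>
  have "norm (blinfun_apply A x) \<le> 1 * norm x" for x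
  proof -
    have "norm (blinfun_apply G x) \<le> norm S * norm (blinfun_apply S x)"
      unfolding G_def blinfun_apply_blinfun_compose
      by (rule order_trans[OF norm_blinfun]) (intro mult_right_mono norm_cadjoint_le S norm_ge_zero)
    then have "(norm (blinfun_apply G x))\<^sup>2 \<le> (norm S * norm (blinfun_apply S x))\<^sup>2"
      by (simp add: power_mono)
    also have "\<dots> \<le> c * inner (blinfun_apply G x) x"
      by (simp add: inner_G c_def power_mult_distrib power2_norm_eq_inner distrib_right)
    finally have "inner (blinfun_apply G x) (blinfun_apply G x) \<le> c * inner (blinfun_apply G x) x"
      by (simp only: power2_norm_eq_inner)
    then have "inner (blinfun_apply G x) (blinfun_apply G x) / c\<^sup>2 \<le> inner (blinfun_apply G x) x / c"
      using c by (simp add: field_simps power2_eq_square)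
    moreover have "0 \<le> inner (blinfun_apply G x) x / c"
      using c by (simp add: inner_G)
    moreover have "(norm (blinfun_apply A x))\<^sup>2 = (norm x)\<^sup>2
        - 2 * (inner (blinfun_apply G x) x / c)
        + inner (blinfun_apply G x) (blinfun_apply G x) / c\<^sup>2"
      unfolding A_apply power2_norm_eq_inner
      by (simp add: inner_diff_left inner_diff_right inner_commute power2_eq_square)
    ultimately have "(norm (blinfun_apply A x))\<^sup>2 \<le> (norm x)\<^sup>2"
      by linarith
    then show ?thesis
      by (simp add: power2_le_iff_abs_le)
  qed
  then have "norm A \<le> 1"
    by (intro norm_blinfun_bound) auto
  then obtain B where B: "B = (1/2) *\<^sub>R (A + (B o\<^sub>L B))" "norm B \<le> 1"
    and inv: "\<And>Q. closed Q \<Longrightarrow> 0 \<in> Q \<Longrightarrow> (\<And>X. X \<in> Q \<Longrightarrow> (1/2) *\<^sub>R (A + (X o\<^sub>L X)) \<in> Q) \<Longrightarrow> B \<in> Q"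
    using ex_fixed_point_sqrt_iteration[of A] by metis
  have B_sq: "blinfun_apply B (blinfun_apply B x) = 2 *\<^sub>R blinfun_apply B x - blinfun_apply A x" for x
    using arg_cong[OF B(1), of "\<lambda>X. 2 *\<^sub>R blinfun_apply X x"]
    by (simp add: blinfun.bilinear_simps)
  have "B \<in> {X. \<forall>x. blinfun_apply X (\<i> *\<^sub>C x) = \<i> *\<^sub>C blinfun_apply X x}"
    by (rule inv)
      (auto simp: blinfun.bilinear_simps A_apply clinear_opD[OF G_lin] scaleC_add_right
        scaleC_diff_right scaleC_scaleR scaleC_zero_right
        intro!: closed_Collect_all closed_Collect_eq continuous_intros)
  then have B_lin: "clinear_op B"
    by (intro clinear_opI) simp
  have "B \<in> {X. \<forall>x y. inner (blinfun_apply X x) y = inner x (blinfun_apply X y)}"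
    by (rule inv)
      (auto simp: blinfun.bilinear_simps A_apply inner_add_left inner_add_right inner_diff_left
        inner_diff_right inner_G
        intro!: closed_Collect_all closed_Collect_eq continuous_intros)
  then have B_sym: "inner (blinfun_apply B x) y = inner x (blinfun_apply B y)" for x y
    by simp
  have B_comm: "C o\<^sub>L B = B o\<^sub>L C" if "C o\<^sub>L G = G o\<^sub>L C" for C
  proof -
    have CG: "blinfun_apply C (blinfun_apply G x) = blinfun_apply G (blinfun_apply C x)" for x
      using that by (metis blinfun_apply_blinfun_compose)
    have "B \<in> {X. \<forall>x. blinfun_apply C (blinfun_apply X x) = blinfun_apply X (blinfun_apply C x)}"
      by (rule inv)
        (auto simp: blinfun.bilinear_simps A_apply CG
          intro!: closed_Collect_all closed_Collect_eq continuous_intros)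
    then show ?thesis
      by (intro blinfun_eqI) simp
  qed
  define P where "P = sqrt c *\<^sub>R (id_blinfun - B)"
  have P_apply: "blinfun_apply P x = sqrt c *\<^sub>R (x - blinfun_apply B x)" for x
    by (simp add: P_def blinfun.bilinear_simps)
  have "positive_op P"
  proof (rule positive_opI)
    show "clinear_op P"
      unfolding clinear_op_def
      by (simp add: P_apply clinear_opD[OF B_lin] scaleC_scaleR flip: scaleC_diff_right)
    show "inner (blinfun_apply P x) y = inner x (blinfun_apply P y)" for x y
      by (simp add: P_apply inner_diff_left inner_diff_right B_sym)
    show "0 \<le> inner (blinfun_apply P x) x" for x
    proof -
      have "inner (blinfun_apply B x) x \<le> norm (blinfun_apply B x) * norm x"
        by (rule norm_cauchy_schwarz)
      also have "\<dots> \<le> (1 * norm x) * norm x"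
        by (intro mult_right_mono order_trans[OF norm_blinfun] B norm_ge_zero)
      finally show ?thesis
        using c by (simp add: P_apply inner_diff_left power2_eq_square flip: power2_norm_eq_inner)
    qed
  qed
  moreover have "P o\<^sub>L P = G"
  proof (rule blinfun_eqI)
    fix x
    \<comment> \<open>By the fixed point equation \<open>B\<^sup>2 = 2B - A\<close>, so
      \<open>(1 - B)\<^sup>2 = 1 - A\<close>.\<close>
    have "blinfun_apply (P o\<^sub>L P) x = c *\<^sub>R (x - blinfun_apply A x)"
      using c by (simp add: P_apply blinfun.bilinear_simps B_sq algebra_simps scaleR_2)
    then show "blinfun_apply (P o\<^sub>L P) x = blinfun_apply G x"
      using c by (simp add: A_apply)
  qed
  moreover have "C o\<^sub>L P = P o\<^sub>L C" if "C o\<^sub>L G = G o\<^sub>L C" for C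
    using B_comm[OF that]
    by (intro blinfun_eqI)
      (simp add: P_apply blinfun.bilinear_simps, metis blinfun_apply_blinfun_compose)
  ultimately show ?thesis
    unfolding G_def by blast
qed

section \<open>The modulus of an operator\<close>

lemma
  assumes S: "clinear_op S"
  shows positive_abs_op: "positive_op (abs_op S)"
    and abs_op_squared: "abs_op S o\<^sub>L abs_op S = cadjoint S o\<^sub>L S"
proof -
  have "\<exists>!P. positive_op P \<and> P o\<^sub>L P = cadjoint S o\<^sub>L S"
  proof -
    obtain P where P: "positive_op P" "P o\<^sub>L P = cadjoint S o\<^sub>L S"
      and comm: "\<And>C. C o\<^sub>L (cadjoint S o\<^sub>L S) = (cadjoint S o\<^sub>L S) o\<^sub>L C \<Longrightarrow> C o\<^sub>L P = P o\<^sub>L C"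
      using ex_positive_sqrt[OF S] by blast
    have "Q = P" if Q: "positive_op Q" "Q o\<^sub>L Q = cadjoint S o\<^sub>L S" for Q
    proof (rule positive_sqrt_unique)
      \<comment> \<open>\<open>Q\<close> commutes with its own square, which is
        \<open>cadjoint S o\<^sub>L S\<close>, hence with \<open>P\<close>.\<close>
      show "Q o\<^sub>L P = P o\<^sub>L Q"
        by (intro comm blinfun_eqI) (simp flip: Q(2))
    qed (use P Q in simp_all)
    then show ?thesis
      using P by blast
  qed
  then have "positive_op (abs_op S) \<and> abs_op S o\<^sub>L abs_op S = cadjoint S o\<^sub>L S"
    unfolding abs_op_def sqrt_op_def by (rule theI')
  then show "positive_op (abs_op S)" "abs_op S o\<^sub>L abs_op S = cadjoint S o\<^sub>L S"
    by blast+
qed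

lemma norm_abs_op_apply:
  assumes S: "clinear_op S"
  shows "norm (blinfun_apply (abs_op S) x) = norm (blinfun_apply S x)"
proof -
  have "inner (blinfun_apply (abs_op S) x) (blinfun_apply (abs_op S) x)
      = inner x (blinfun_apply (abs_op S o\<^sub>L abs_op S) x)"
    by (simp add: positive_op_inner_symmetric[OF positive_abs_op[OF S]])
  also have "\<dots> = inner (blinfun_apply S x) (blinfun_apply S x)"
    by (simp add: abs_op_squared[OF S] inner_cadjoint_right[OF S])
  finally show ?thesis
    by (simp add: norm_eq_sqrt_inner)
qed

section \<open>Polar decomposition\<close>

lemma subspace_closure:
  fixes V :: "'a::real_normed_vector set"
  assumes V: "subspace V"
  shows "subspace (closure V)"
proof (rule subspaceI)
  show "0 \<in> closure V"
    using subspace_0[OF V] closure_subset by blast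
next
  fix x y
  assume "x \<in> closure V" "y \<in> closure V"
  then obtain a b where "\<And>n. a n \<in> V" "a \<longlonglongrightarrow> x" "\<And>n. b n \<in> V" "b \<longlonglongrightarrow> y"
    by (metis closure_sequential)
  then have "(\<forall>n. a n + b n \<in> V) \<and> (\<lambda>n. a n + b n) \<longlonglongrightarrow> x + y"
    using V by (auto intro: subspace_add tendsto_add)
  then show "x + y \<in> closure V"
    unfolding closure_sequential by (intro exI[of _ "\<lambda>n. a n + b n"])
next
  fix r x
  assume "x \<in> closure V"
  then obtain a where "\<And>n. a n \<in> V" "a \<longlonglongrightarrow> x"
    by (metis closure_sequential)
  then have "(\<forall>n. r *\<^sub>R a n \<in> V) \<and> (\<lambda>n. r *\<^sub>R a n) \<longlonglongrightarrow> r *\<^sub>R x"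
    using V by (auto intro: subspace_scale tendsto_scaleR)
  then show "r *\<^sub>R x \<in> closure V"
    unfolding closure_sequential by (intro exI[of _ "\<lambda>n. r *\<^sub>R a n"])
qed

lemma clinear_op_abs_op: "clinear_op S \<Longrightarrow> clinear_op (abs_op S)"
  using positive_abs_op unfolding positive_op_def by blast

text \<open>The graph of \<open>|S|u \<mapsto> Su\<close> is isometric; its closure is the graph of the polar factor on the
  closed range of \<open>|S|\<close>, and the factor vanishes on the orthogonal complement.\<close>

lemma ex_polar_factor:
  fixes S :: "'a::chilbert_space \<Rightarrow>\<^sub>L 'b::chilbert_space"
  assumes S: "clinear_op S"
  shows "\<exists>U. partial_isometry U \<and> ker_op U = ker_op S \<and> S = U o\<^sub>L abs_op S"
proof -
  define M where "M = abs_op S"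
  have M_lin: "clinear_op M" and M_norm: "\<And>x. norm (blinfun_apply M x) = norm (blinfun_apply S x)"
    and M_sym: "\<And>x y. inner (blinfun_apply M x) y = inner x (blinfun_apply M y)"
    unfolding M_def using S
    by (simp_all add: clinear_op_abs_op norm_abs_op_apply positive_op_inner_symmetric positive_abs_op)
  define f where "f = (\<lambda>u. (blinfun_apply M u, blinfun_apply S u))"
  define G where "G = closure (range f)"
  define K where "K = fst ` G"
  have "linear f"
    by (rule linearI) (simp_all add: f_def blinfun.bilinear_simps)
  then have "subspace (range f)"
    by (intro linear_subspace_image subspace_UNIV)
  then have G: "subspace G"
    unfolding G_def by (rule subspace_closure)
  have K: "subspace K"
    unfolding K_def by (intro linear_subspace_image G bounded_linear.linear bounded_linear_fst)
  have f_G: "(blinfun_apply M u, blinfun_apply S u) \<in> G" for u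
    unfolding G_def f_def by (intro closure_subset[THEN subsetD] rangeI)
  \<comment> \<open>Equality of the two norms is a closed condition, so the closed relation
    \<open>G\<close> is still isometric and in particular single-valued.\<close>
  have "G \<subseteq> {p. norm (fst p) = norm (snd p)}"
    unfolding G_def
    by (intro closure_minimal closed_Collect_eq continuous_intros) (auto simp: f_def M_norm)
  then have G_norm: "norm a = norm b" if "(a, b) \<in> G" for a b
    using that by auto
  have "closed {p. (\<i> *\<^sub>C fst p, \<i> *\<^sub>C snd p) \<in> G}"
  proof -
    have "closed ((\<lambda>p. (\<i> *\<^sub>C fst p, \<i> *\<^sub>C snd p)) -` G)"
      unfolding G_def by (intro closed_vimage closed_closure continuous_intros)
    then show ?thesis
      by (simp add: vimage_def)
  qed
  then have "G \<subseteq> {p. (\<i> *\<^sub>C fst p, \<i> *\<^sub>C snd p) \<in> G}"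
    unfolding G_def
    by (rule closure_minimal[rotated])
      (auto simp: f_def simp flip: clinear_opD[OF M_lin] clinear_opD[OF S]
        intro!: closure_subset[THEN subsetD])
  then have G_i: "(\<i> *\<^sub>C a, \<i> *\<^sub>C b) \<in> G" if "(a, b) \<in> G" for a b
    using that by auto
  have "complete G"
    unfolding G_def by (simp add: complete_eq_closed)
  \<comment> \<open>On \<open>G\<close> the first projection is bounded below, because the
    components have equal norms; so it maps the complete set \<open>G\<close> to a complete
    set.\<close>
  have "closed K"
  proof -
    have "complete (fst ` G)"
    proof (rule complete_isometric_image)
      show "0 < (1 / 2 :: real)"
        by simp
      show "\<forall>x\<in>G. 1 / 2 * norm x \<le> norm (fst x)"
      proof
        fix p
        assume "p \<in> G"
        then have "norm (fst p) = norm (snd p)"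
          using G_norm by (metis prod.collapse)
        then show "1 / 2 * norm p \<le> norm (fst p)"
          using norm_Pair_le[of "fst p" "snd p"] by simp
      qed
    qed (use G \<open>complete G\<close> bounded_linear_fst in auto)
    then show ?thesis
      unfolding K_def by (rule complete_imp_closed)
  qed
  have "\<exists>b. \<exists>p. (p, b) \<in> G \<and> (\<forall>k\<in>K. inner (x - p) k = 0)" for x
    using ex_orthogonal_projection[OF K \<open>closed K\<close>, of x] by (force simp: K_def)
  then obtain g where "\<And>x. \<exists>p. (p, g x) \<in> G \<and> (\<forall>k\<in>K. inner (x - p) k = 0)"
    by metis
  then obtain P where P: "\<And>x. (P x, g x) \<in> G" "\<And>x k. k \<in> K \<Longrightarrow> inner (x - P x) k = 0"
    by metis
  \<comment> \<open>Two candidates differ by an element of \<open>G\<close> whose first component is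
    both in \<open>K\<close> and orthogonal to \<open>K\<close>, hence 0; isometry then kills the
    second. Linearity of \<open>g\<close> and the polar identity reduce to this.\<close>
  have g_eqI: "b = g x" if "(p, b) \<in> G" "\<And>k. k \<in> K \<Longrightarrow> inner (x - p) k = 0" for x p b
  proof -
    have diff: "(p - P x, b - g x) \<in> G"
      using subspace_diff[OF G that(1) P(1)] by simp
    then have "p - P x \<in> K"
      unfolding K_def by (metis fst_conv imageI)
    then have "inner ((x - P x) - (x - p)) (p - P x) = 0"
      using P(2) that(2) by (simp only: inner_diff_left)
    then have "p - P x = 0"
      by simp
    then show ?thesis
      using G_norm[OF diff] by simp
  qed
  have P_norm: "norm (P x) \<le> norm x" for x
  proof -
    have "inner (x - P x) (P x) = 0"
      using P unfolding K_def by (metis fst_conv imageI)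
    then have "(norm (P x))\<^sup>2 = inner x (P x)"
      by (simp add: inner_diff_left power2_norm_eq_inner)
    also have "\<dots> \<le> norm x * norm (P x)"
      by (rule norm_cauchy_schwarz)
    finally show ?thesis
      by (cases "P x = 0") (simp_all add: power2_eq_square)
  qed
  have "bounded_linear g"
  proof (rule bounded_linear_intro[where K = 1])
    show "g (x + y) = g x + g y" for x y
    proof (rule g_eqI[symmetric])
      show "(P x + P y, g x + g y) \<in> G"
        using subspace_add[OF G P(1) P(1)] by simp
      show "inner (x + y - (P x + P y)) k = 0" if "k \<in> K" for k
        using P(2)[OF that, of x] P(2)[OF that, of y]
        by (simp add: inner_diff_left inner_add_left)
    qed
    show "g (r *\<^sub>R x) = r *\<^sub>R g x" for r x
    proof (rule g_eqI[symmetric])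
      show "(r *\<^sub>R P x, r *\<^sub>R g x) \<in> G"
        using subspace_scale[OF G P(1)] by simp
      show "inner (r *\<^sub>R x - r *\<^sub>R P x) k = 0" if "k \<in> K" for k
        using P(2)[OF that, of x] by (simp flip: scaleR_diff_right)
    qed
    show "norm (g x) \<le> norm x * 1" for x
      using G_norm[OF P(1)] P_norm by simp
  qed
  then have U: "blinfun_apply (Blinfun g) = g"
    by (rule bounded_linear_Blinfun_apply)
  have U_lin: "clinear_op (Blinfun g)"
  proof (rule clinear_opI)
    fix x
    have "\<i> *\<^sub>C g x = g (\<i> *\<^sub>C x)"
    proof (rule g_eqI)
      show "(\<i> *\<^sub>C P x, \<i> *\<^sub>C g x) \<in> G"
        by (intro G_i P)
      fix k
      assume "k \<in> K"
      \<comment> \<open>\<open>K\<close> is invariant under \<open>\<i>\<close>, so real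
        orthogonality to \<open>K\<close> is preserved when a vector is multiplied by
        \<open>\<i>\<close>.\<close>
      then have "- \<i> *\<^sub>C k \<in> K"
        using G_i subspace_neg[OF K] by (force simp: K_def scaleC_minus_left)
      then have "inner (x - P x) (- \<i> *\<^sub>C k) = 0"
        by (rule P(2))
      then show "inner (\<i> *\<^sub>C x - \<i> *\<^sub>C P x) k = 0"
        by (simp add: inner_eq_Re_cinner cinner_scaleC_left cinner_scaleC_right
            flip: scaleC_diff_right)
    qed
    then show "blinfun_apply (Blinfun g) (\<i> *\<^sub>C x) = \<i> *\<^sub>C blinfun_apply (Blinfun g) x"
      by (simp add: U)
  qed
  have g_eq_0: "g x = 0 \<longleftrightarrow> blinfun_apply S x = 0" for x
  proof
    assume "g x = 0"
    then have "P x = 0"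
      using G_norm[OF P(1)[of x]] by simp
    \<comment> \<open>Now \<open>x\<close> is orthogonal to \<open>K\<close>; by symmetry of
      \<open>M\<close>, testing against \<open>M (M x)\<close> yields the squared norm of
      \<open>M x\<close>.\<close>
    then have "inner x (blinfun_apply M (blinfun_apply M x)) = 0"
      using P(2)[of "blinfun_apply M (blinfun_apply M x)" x] f_G unfolding K_def
      by (metis diff_zero fst_conv imageI)
    then show "blinfun_apply S x = 0"
      using M_norm[of x] M_sym[of x "blinfun_apply M x"] by simp
  next
    assume "blinfun_apply S x = 0"
    then have Mx: "blinfun_apply M x = 0"
      using M_norm[of x] by simp
    \<comment> \<open>As \<open>M\<close> is symmetric, its kernel is orthogonal to its range and so
      to \<open>K\<close>; hence \<open>x\<close> projects to 0.\<close>
    have "G \<subseteq> {p. inner x (fst p) = 0}"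
      unfolding G_def
      by (intro closure_minimal closed_Collect_eq continuous_intros)
        (auto simp: f_def Mx simp flip: M_sym)
    then have "inner (x - 0) k = 0" if "k \<in> K" for k
      using that by (auto simp: K_def)
    moreover have "(0, 0) \<in> G"
      using subspace_0[OF G] by (simp add: zero_prod_def)
    ultimately show "g x = 0"
      using g_eqI by metis
  qed
  then have ker: "ker_op (Blinfun g) = ker_op S"
    by (simp add: ker_op_def U)
  have "partial_isometry (Blinfun g)"
    unfolding partial_isometry_def
  proof (intro conjI allI impI U_lin)
    fix x
    assume x: "\<forall>z\<in>ker_op (Blinfun g). cinner x z = 0"
    have PxK: "P x \<in> K"
      using P(1) unfolding K_def by (metis fst_conv imageI)
    \<comment> \<open>\<open>P x\<close> is its own projection. The remainder \<open>x - P x\<close>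
      therefore lies in the kernel of \<open>g\<close>, to which \<open>x\<close> is orthogonal, and
      this forces \<open>P x = x\<close>.\<close>
    have "g (P x) = g x"
      using P(1) by (intro g_eqI[symmetric]) auto
    then have "x - P x \<in> ker_op (Blinfun g)"
      using blinfun.diff_right[of "Blinfun g"] by (simp add: ker_op_def U)
    then have "inner x (x - P x) = 0"
      using x by (simp add: inner_eq_Re_cinner)
    moreover have "inner (P x) (x - P x) = 0"
      using P(2)[OF PxK, of x] by (simp add: inner_commute)
    ultimately have "inner (x - P x) (x - P x) = 0"
      by (simp only: inner_diff_left)
    then have "P x = x"
      by simp
    then show "norm (blinfun_apply (Blinfun g) x) = norm x"
      using G_norm[OF P(1)[of x]] by (simp add: U)
  qed
  moreover have "S = Blinfun g o\<^sub>L M"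
    using f_G by (intro blinfun_eqI) (auto simp: U intro!: g_eqI)
  ultimately show ?thesis
    using ker unfolding M_def by blast
qed

text \<open>Both factors are prescribed on the range of the modulus, hence on its closure. The
  orthogonal complement lies in the kernel of \<open>S\<close>, where both vanish by the kernel
  conditions.\<close>

lemma polar_factor_unique:
  fixes S :: "'a::chilbert_space \<Rightarrow>\<^sub>L 'b::chilbert_space"
  assumes S: "clinear_op S"
    and U: "ker_op U = ker_op S" "S = U o\<^sub>L abs_op S"
    and V: "ker_op V = ker_op S" "S = V o\<^sub>L abs_op S"
  shows "U = V"
proof (rule blinfun_eqI)
  fix x
  define M where "M = abs_op S"
  define K where "K = closure (range (blinfun_apply M))"
  have "subspace K"
    unfolding K_def
    by (intro subspace_closure linear_subspace_image subspace_UNIV bounded_linear.linear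
        blinfun.bounded_linear_right)
  then obtain p where p: "p \<in> K" "\<And>k. k \<in> K \<Longrightarrow> inner (x - p) k = 0"
    using ex_orthogonal_projection[of K x] by (auto simp: K_def)
  have "blinfun_apply (U o\<^sub>L M) u = blinfun_apply (V o\<^sub>L M) u" for u
    using U(2) V(2) unfolding M_def by metis
  then have "K \<subseteq> {k. blinfun_apply U k = blinfun_apply V k}"
    unfolding K_def by (intro closure_minimal closed_Collect_eq continuous_intros) auto
  then have "blinfun_apply U p = blinfun_apply V p"
    using p(1) by blast
  moreover have "x - p \<in> ker_op S"
  proof -
    let ?y = "x - p"
    have "inner ?y (blinfun_apply M (blinfun_apply M ?y)) = 0"
      unfolding K_def by (intro p(2)[unfolded K_def] closure_subset[THEN subsetD] rangeI)
    then have "blinfun_apply M ?y = 0"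
      using positive_op_inner_symmetric[OF positive_abs_op[OF S], of ?y "blinfun_apply M ?y"]
      by (simp add: M_def)
    then show ?thesis
      using norm_abs_op_apply[OF S, of ?y] by (simp add: ker_op_def M_def)
  qed
  then have "blinfun_apply U (x - p) = 0" "blinfun_apply V (x - p) = 0"
    using U(1) V(1) by (auto simp: ker_op_def)
  ultimately show "blinfun_apply U x = blinfun_apply V x"
    by (simp add: blinfun.bilinear_simps)
qed

text \<open>Complex linearity of the polar factor is part of being a partial isometry, so it is
  available once the description is known to denote.\<close>

lemma clinear_op_duggal_transform:
  assumes S: "clinear_op S"
  shows "clinear_op (duggal_transform S)"
proof -
  have "\<exists>!U. partial_isometry U \<and> ker_op U = ker_op S \<and> S = U o\<^sub>L abs_op S"
    by (rule ex_ex1I) (use ex_polar_factor[OF S] polar_factor_unique[OF S] in blast)+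
  then have "partial_isometry (polar_factor S)"
    unfolding polar_factor_def by (rule theI'[THEN conjunct1])
  then show ?thesis
    unfolding duggal_transform_def partial_isometry_def
    by (intro clinear_op_compose clinear_op_abs_op S) simp
qed

section \<open>Numerical radius\<close>

lemma bdd_above_numerical_range:
  "bdd_above ((\<lambda>x. cmod (cinner (blinfun_apply S x) x)) ` {x. norm x = 1})"
proof (rule bdd_aboveI2)
  fix x :: 'a
  assume "x \<in> {x. norm x = 1}"
  then show "cmod (cinner (blinfun_apply S x) x) \<le> norm S"
    using norm_cinner_le[of "blinfun_apply S x" x] norm_blinfun[of S x] by simp
qed

lemma numerical_radius_bound: "cmod (cinner (blinfun_apply S x) x) \<le> numerical_radius S * (norm x)\<^sup>2"
proof (cases "x = 0")
  case False
  define u where "u = (1 / norm x) *\<^sub>R x"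
  have u: "norm u = 1" "x = norm x *\<^sub>R u"
    using False by (simp_all add: u_def)
  then have "cmod (cinner (blinfun_apply S u) u) \<le> numerical_radius S"
    unfolding numerical_radius_def by (auto intro!: cSUP_upper bdd_above_numerical_range)
  moreover have "cmod (cinner (blinfun_apply S x) x) = cmod (cinner (blinfun_apply S u) u) * (norm x)\<^sup>2"
    by (subst (1 2) u(2))
      (simp add: blinfun.bilinear_simps cinner_scaleR_left cinner_scaleR_right norm_mult
        power2_eq_square)
  ultimately show ?thesis
    by (simp add: mult_right_mono)
qed simp

text \<open>The assumption \<open>0 \<le> b\<close> settles the zero space, where there are no unit
  vectors and the value is 0.\<close>

lemma numerical_radius_least:
  assumes "0 \<le> b" and "\<And>x. norm x = 1 \<Longrightarrow> cmod (cinner (blinfun_apply S x) x) \<le> b"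
  shows "numerical_radius S \<le> b"
  using assms unfolding numerical_radius_def by (auto intro!: cSUP_least)

lemma numerical_radius_nonneg: "0 \<le> numerical_radius S"
proof (cases "\<exists>x::'a. norm x = 1")
  case True
  then obtain x :: 'a where "norm x = 1"
    by blast
  then show ?thesis
    using order_trans[OF norm_ge_zero numerical_radius_bound[of S x]] by simp
qed (simp add: numerical_radius_def)

lemma numerical_radius_le_norm: "numerical_radius S \<le> norm S"
proof (rule numerical_radius_least)
  show "cmod (cinner (blinfun_apply S x) x) \<le> norm S" if "norm x = 1" for x
    using norm_cinner_le[of "blinfun_apply S x" x] norm_blinfun[of S x] that by simp
qed simp

lemma numerical_radius_triangle: "numerical_radius (S + R) \<le> numerical_radius S + numerical_radius R"
proof (rule numerical_radius_least)
  fix x :: 'a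
  assume "norm x = 1"
  then show "cmod (cinner (blinfun_apply (S + R) x) x) \<le> numerical_radius S + numerical_radius R"
    using norm_triangle_ineq[of "cinner (blinfun_apply S x) x" "cinner (blinfun_apply R x) x"]
      numerical_radius_bound[of S x] numerical_radius_bound[of R x]
    by (simp add: blinfun.add_left cinner_add_left)
qed (simp add: numerical_radius_nonneg)

lemma numerical_radius_scaleR_le: "numerical_radius (r *\<^sub>R S) \<le> \<bar>r\<bar> * numerical_radius S"
proof (rule numerical_radius_least)
  fix x :: 'a
  assume "norm x = 1"
  then show "cmod (cinner (blinfun_apply (r *\<^sub>R S) x) x) \<le> \<bar>r\<bar> * numerical_radius S"
    using numerical_radius_bound[of S x]
    by (simp add: blinfun.scaleR_left cinner_scaleR_left norm_mult mult_left_mono)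
qed (simp add: numerical_radius_nonneg)

lemma numerical_radius_scaleR: "numerical_radius (r *\<^sub>R S) = \<bar>r\<bar> * numerical_radius S"
proof (rule antisym[OF numerical_radius_scaleR_le])
  show "\<bar>r\<bar> * numerical_radius S \<le> numerical_radius (r *\<^sub>R S)"
  proof (cases "r = 0")
    case False
    then show ?thesis
      using mult_left_mono[OF numerical_radius_scaleR_le[of "1 / r" "r *\<^sub>R S"], of "\<bar>r\<bar>"]
      by (simp add: numerical_radius_nonneg)
  qed (simp add: numerical_radius_nonneg)
qed

text \<open>A seminorm dominated by the operator norm is 1-Lipschitz. Continuity is needed for the
  integrability of the integrand.\<close>

lemma continuous_on_numerical_radius: "continuous_on A numerical_radius"
proof -
  have le: "numerical_radius S - numerical_radius R \<le> norm (S - R)" for S R :: "'a \<Rightarrow>\<^sub>L 'a"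
    using numerical_radius_triangle[of "S - R" R] numerical_radius_le_norm[of "S - R"] by simp
  have "dist (numerical_radius S) (numerical_radius R) \<le> 1 * dist S R" for S R :: "'a \<Rightarrow>\<^sub>L 'a"
    using le[of S R] le[of R S] by (simp add: dist_norm norm_minus_commute abs_le_iff)
  then have "1-lipschitz_on A numerical_radius"
    by (intro lipschitz_onI) auto
  then show ?thesis
    by (rule lipschitz_on_continuous_on)
qed

section \<open>Off-diagonal block operators\<close>

lemma cinner_off_diagonal:
  fixes A B :: "'a::chilbert_space \<Rightarrow>\<^sub>L 'a"
  assumes B: "clinear_op B"
  shows "cinner (blinfun_apply (op_matrix 0 A (cadjoint B) 0) (x, y)) (x, y)
    = cinner (blinfun_apply A y) x + cnj (cinner (blinfun_apply B y) x)"
  by (simp add: op_matrix.rep_eq cinner_prod_def cinner_cadjoint_left[OF B] flip: cinner_commute)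

lemma norm_add_le_numerical_radius_off_diagonal:
  fixes A B :: "'a::chilbert_space \<Rightarrow>\<^sub>L 'a"
  assumes B: "clinear_op B"
  shows "norm (A + B) \<le> 2 * numerical_radius (op_matrix 0 A (cadjoint B) 0)"
proof (rule norm_blinfun_bound)
  let ?M = "op_matrix 0 A (cadjoint B) 0"
  fix y
  let ?z = "blinfun_apply (A + B) y"
  show "norm ?z \<le> 2 * numerical_radius ?M * norm y"
  proof (cases "?z = 0")
    case False
    \<comment> \<open>The direction attains the norm of \<open>?z\<close> in the inner product. The
      scaling to the norm of \<open>y\<close> makes the squared norm of \<open>(x, y)\<close> twice
      that of \<open>y\<close>, the source of the factor 2.\<close>
    define x where "x = (norm y / norm ?z) *\<^sub>R ?z"
    have x: "norm x = norm y"
      using False by (simp add: x_def)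
    have "norm ?z * norm y = inner ?z x"
      using False by (simp add: x_def power2_eq_square flip: power2_norm_eq_inner)
    also have "\<dots> = Re (cinner (blinfun_apply ?M (x, y)) (x, y))"
      by (simp add: cinner_off_diagonal[OF B] inner_eq_Re_cinner blinfun.add_left cinner_add_left)
    also have "\<dots> \<le> numerical_radius ?M * (norm (x, y))\<^sup>2"
      by (rule order_trans[OF complex_Re_le_cmod numerical_radius_bound])
    also have "\<dots> = (2 * numerical_radius ?M * norm y) * norm y"
      by (simp add: norm_Pair x power2_eq_square)
    finally show ?thesis
      using False by (cases "y = 0") simp_all
  qed (simp add: numerical_radius_nonneg)
qed (simp add: numerical_radius_nonneg)

text \<open>The two block operators are adjoint to each other.\<close>

lemma numerical_radius_off_diagonal_swap:
  fixes A B :: "'a::chilbert_space \<Rightarrow>\<^sub>L 'a"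
  assumes A: "clinear_op A" and B: "clinear_op B"
  shows "numerical_radius (op_matrix 0 A (cadjoint B) 0)
    = numerical_radius (op_matrix 0 B (cadjoint A) 0)"
proof -
  have "cmod (cinner (blinfun_apply (op_matrix 0 A (cadjoint B) 0) p) p)
      = cmod (cinner (blinfun_apply (op_matrix 0 B (cadjoint A) 0) p) p)" for p
  proof (cases p)
    case (Pair x y)
    have "cinner (blinfun_apply (op_matrix 0 B (cadjoint A) 0) p) p
        = cnj (cinner (blinfun_apply (op_matrix 0 A (cadjoint B) 0) p) p)"
      by (simp add: Pair cinner_off_diagonal[OF A] cinner_off_diagonal[OF B])
    then show ?thesis
      by simp
  qed
  then show ?thesis
    by (simp add: numerical_radius_def)
qed

text \<open>A unit \<open>c\<close> with \<open>c (\<langle>Ay,x\<rangle> + cnj \<langle>By,x\<rangle>) \<ge> 0\<close> turns the quadratic form into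
  \<open>Re \<langle>(cA + cnj c B) y, x\<rangle>\<close>, and \<open>\<parallel>x\<parallel> \<parallel>y\<parallel> \<le> 1 / 2\<close> on the unit sphere.\<close>

lemma numerical_radius_off_diagonal_le:
  fixes A B :: "'a::chilbert_space \<Rightarrow>\<^sub>L 'a"
  assumes A: "clinear_op A" and B: "clinear_op B"
  shows "2 * numerical_radius (op_matrix 0 A (cadjoint B) 0)
    \<le> sqrt (norm ((cadjoint A o\<^sub>L A) + (cadjoint B o\<^sub>L B)) + 2 * numerical_radius (cadjoint A o\<^sub>L B))"
    (is "_ \<le> sqrt (?N + 2 * ?w)")
proof -
  define s where "s = sqrt (?N + 2 * ?w)"
  have s_nonneg: "0 \<le> s"
    by (simp add: s_def numerical_radius_nonneg)
  have s_sq: "s\<^sup>2 = ?N + 2 * ?w"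
    by (simp add: s_def numerical_radius_nonneg)
  have "cmod (cinner (blinfun_apply (op_matrix 0 A (cadjoint B) 0) (x, y)) (x, y)) \<le> s / 2"
    if xy: "norm (x, y) = 1" for x y
  proof -
    let ?a = "blinfun_apply A y" and ?b = "blinfun_apply B y"
    obtain c where c: "cmod c = 1"
      "c * (cinner ?a x + cnj (cinner ?b x)) = of_real (cmod (cinner ?a x + cnj (cinner ?b x)))"
      using ex_unit_mult_eq_cmod by blast
    define v where "v = c *\<^sub>C ?a + cnj c *\<^sub>C ?b"
    have "cmod (cinner ?a x + cnj (cinner ?b x)) = Re (c * cinner ?a x + cnj (cnj c * cinner ?b x))"
      using arg_cong[OF c(2), of Re] by (simp add: algebra_simps)
    \<comment> \<open>Conjugation does not change real parts, so both terms become linear in the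
      first argument and merge into one inner product with \<open>v\<close>.\<close>
    also have "\<dots> = Re (c * cinner ?a x + cnj c * cinner ?b x)"
      by simp
    also have "\<dots> = inner v x"
      by (simp add: v_def inner_eq_Re_cinner cinner_add_left cinner_scaleC_left)
    also have "\<dots> \<le> norm v * norm x"
      by (rule norm_cauchy_schwarz)
    finally have le: "cmod (cinner ?a x + cnj (cinner ?b x)) \<le> norm v * norm x" .
    have "(norm v)\<^sup>2 = (norm (c *\<^sub>C ?a))\<^sup>2 + (norm (cnj c *\<^sub>C ?b))\<^sup>2
        + 2 * inner (c *\<^sub>C ?a) (cnj c *\<^sub>C ?b)"
      unfolding v_def power2_norm_eq_inner inner_add_left inner_add_right
        inner_commute[of "cnj c *\<^sub>C ?b" "c *\<^sub>C ?a"] by simp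
    then have v_sq: "(norm v)\<^sup>2 = (norm ?a)\<^sup>2 + (norm ?b)\<^sup>2 + 2 * inner (c *\<^sub>C ?a) (cnj c *\<^sub>C ?b)"
      by (simp add: norm_scaleC c(1))
    let ?S = "(cadjoint A o\<^sub>L A) + (cadjoint B o\<^sub>L B)"
    have "(norm ?a)\<^sup>2 + (norm ?b)\<^sup>2 = inner (blinfun_apply ?S y) y"
      by (simp add: blinfun.add_left inner_add_left inner_cadjoint_left A B power2_norm_eq_inner)
    also have "\<dots> \<le> norm (blinfun_apply ?S y) * norm y"
      by (rule norm_cauchy_schwarz)
    also have "\<dots> \<le> (?N * norm y) * norm y"
      by (intro mult_right_mono norm_blinfun norm_ge_zero)
    finally have squares: "(norm ?a)\<^sup>2 + (norm ?b)\<^sup>2 \<le> ?N * (norm y)\<^sup>2"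
      by (simp add: power2_eq_square)
    \<comment> \<open>The unit factors disappear in the modulus, so the cross term has a bound
      independent of \<open>c\<close>, and hence of \<open>x\<close>.\<close>
    have "inner (c *\<^sub>C ?a) (cnj c *\<^sub>C ?b) \<le> cmod (cinner (c *\<^sub>C ?a) (cnj c *\<^sub>C ?b))"
      unfolding inner_eq_Re_cinner by (rule complex_Re_le_cmod)
    also have "\<dots> = cmod (cinner ?a ?b)"
      by (simp add: cinner_scaleC_left cinner_scaleC_right norm_mult c(1))
    also have "\<dots> = cmod (cinner (blinfun_apply (cadjoint A o\<^sub>L B) y) y)"
      by (simp add: cinner_cadjoint_left[OF A] cinner_commute[of ?a ?b])
    also have "\<dots> \<le> ?w * (norm y)\<^sup>2"
      by (rule numerical_radius_bound)
    finally have "(norm v)\<^sup>2 \<le> (s * norm y)\<^sup>2"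
      using v_sq squares unfolding power_mult_distrib s_sq distrib_right by linarith
    then have "norm v \<le> s * norm y"
      using s_nonneg by (simp add: power2_le_iff_abs_le)
    then have "norm v * norm x \<le> s * norm y * norm x"
      by (simp add: mult_right_mono)
    moreover have "2 * (norm y * norm x) \<le> 1"
      using sum_squares_bound[of "norm x" "norm y"] xy by (simp add: norm_Pair algebra_simps)
    then have "s * (2 * (norm y * norm x)) \<le> s * 1"
      using s_nonneg by (rule mult_left_mono)
    ultimately show ?thesis
      using le by (simp add: cinner_off_diagonal[OF B])
  qed
  then have "numerical_radius (op_matrix 0 A (cadjoint B) 0) \<le> s / 2"
    using s_nonneg by (intro numerical_radius_least) auto
  then show ?thesis
    by (simp add: s_def)
qed

text \<open>Bounding each term by norms gives the expansion of the square of
  \<open>norm A + norm B\<close>.\<close>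

lemma sqrt_cadjoint_compose_le:
  fixes A B :: "'a::chilbert_space \<Rightarrow>\<^sub>L 'a"
  assumes A: "clinear_op A" and B: "clinear_op B"
  shows "sqrt (norm ((cadjoint A o\<^sub>L A) + (cadjoint B o\<^sub>L B)) + 2 * numerical_radius (cadjoint A o\<^sub>L B))
    \<le> norm A + norm B"
proof (rule real_le_lsqrt)
  have "norm ((cadjoint A o\<^sub>L A) + (cadjoint B o\<^sub>L B)) \<le> norm A * norm A + norm B * norm B"
    by (intro norm_triangle_le add_mono norm_cadjoint_compose_le A B)
  moreover have "numerical_radius (cadjoint A o\<^sub>L B) \<le> norm A * norm B"
    by (rule order_trans[OF numerical_radius_le_norm norm_cadjoint_compose_le[OF A]])
  ultimately show "norm ((cadjoint A o\<^sub>L A) + (cadjoint B o\<^sub>L B)) + 2 * numerical_radius (cadjoint A o\<^sub>L B)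
      \<le> (norm A + norm B)\<^sup>2"
    by (simp add: power2_eq_square algebra_simps)
qed simp

section \<open>Integral estimate along a segment of block operators\<close>

lemma op_matrix_add:
  "op_matrix A B C D + op_matrix A' B' C' D' = op_matrix (A + A') (B + B') (C + C') (D + D')"
  by (rule blinfun_eqI) (simp add: op_matrix.rep_eq blinfun.add_left)

lemma op_matrix_scaleR:
  "r *\<^sub>R op_matrix A B C D = op_matrix (r *\<^sub>R A) (r *\<^sub>R B) (r *\<^sub>R C) (r *\<^sub>R D)"
  by (rule blinfun_eqI) (simp add: op_matrix.rep_eq blinfun.scaleR_left scaleR_add_right)

lemma norm_add_le_integral_numerical_radius:
  fixes A B :: "'a::chilbert_space \<Rightarrow>\<^sub>L 'a"
  assumes A: "clinear_op A" and B: "clinear_op B"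
  defines "w \<equiv> \<lambda>t. numerical_radius (op_matrix 0 (t *\<^sub>R A + (1 - t) *\<^sub>R B)
    (t *\<^sub>R cadjoint B + (1 - t) *\<^sub>R cadjoint A) 0)"
  shows "norm (A + B) \<le> 2 * integral {0..1} w"
    and "integral {0..1} w \<le> numerical_radius (op_matrix 0 A (cadjoint B) 0)"
proof -
  let ?M = "op_matrix 0 A (cadjoint B) 0" and ?M' = "op_matrix 0 B (cadjoint A) 0"
  \<comment> \<open>The argument runs along the segment from \<open>?M'\<close> at 0 to
    \<open>?M\<close> at 1, which gives continuity of \<open>w\<close> and the convexity
    bound.\<close>
  have w: "w = (\<lambda>t. numerical_radius (t *\<^sub>R ?M + (1 - t) *\<^sub>R ?M'))"
    by (simp add: w_def op_matrix_add op_matrix_scaleR)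
  have "continuous_on {0..1} w"
    unfolding w
    by (intro continuous_on_compose2[OF continuous_on_numerical_radius[of UNIV]] continuous_intros) auto
  then have int: "w integrable_on {0..1}"
    by (rule integrable_continuous_real)
  have lower: "norm (A + B) / 2 \<le> w t" for t
  proof -
    \<comment> \<open>The lower left entry is the adjoint of
      \<open>t *\<^sub>R B + (1 - t) *\<^sub>R A\<close>; adding this to the upper right entry gives
      \<open>A + B\<close> for every \<open>t\<close>.\<close>
    have "norm ((t *\<^sub>R A + (1 - t) *\<^sub>R B) + (t *\<^sub>R B + (1 - t) *\<^sub>R A)) \<le> 2 * w t"
      using norm_add_le_numerical_radius_off_diagonal[of "t *\<^sub>R B + (1 - t) *\<^sub>R A"] A B
      by (simp add: w_def cadjoint_add cadjoint_scaleR clinear_op_add clinear_op_scaleR)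
    then show ?thesis
      by (simp add: algebra_simps)
  qed
  have "integral {0..1} (\<lambda>t::real. norm (A + B) / 2) \<le> integral {0..1} w"
    by (intro integral_le int integrable_const_ivl lower)
  then show "norm (A + B) \<le> 2 * integral {0..1} w"
    by simp
  have upper: "w t \<le> numerical_radius ?M" if "t \<in> {0..1}" for t
  proof -
    have "w t \<le> \<bar>t\<bar> * numerical_radius ?M + \<bar>1 - t\<bar> * numerical_radius ?M'"
      unfolding w
      by (rule order_trans[OF numerical_radius_triangle
            add_mono[OF numerical_radius_scaleR_le numerical_radius_scaleR_le]])
    then show ?thesis
      using that by (simp add: numerical_radius_off_diagonal_swap[OF B A] algebra_simps)
  qed
  have "integral {0..1} w \<le> integral {0..1} (\<lambda>t::real. numerical_radius ?M)"
    by (intro integral_le int integrable_const_ivl upper)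
  then show "integral {0..1} w \<le> numerical_radius ?M"
    by simp
qed

theorem theorem23:
  fixes T :: "'a::chilbert_space \<Rightarrow>\<^sub>L 'a" and l :: real
  assumes "clinear_op T" and "0 \<le> l" and "l \<le> 1"
  shows
    "norm (mean_transform l T)
       \<le> 2 * integral {0..1} (\<lambda>t. numerical_radius
            (op_matrix
              0 ((l * t) *\<^sub>R T + ((1 - l) * (1 - t)) *\<^sub>R duggal_transform T)
              (((1 - l) * t) *\<^sub>R cadjoint (duggal_transform T) + (l * (1 - t)) *\<^sub>R cadjoint T) 0))
     \<and> 2 * integral {0..1} (\<lambda>t. numerical_radius
            (op_matrix
              0 ((l * t) *\<^sub>R T + ((1 - l) * (1 - t)) *\<^sub>R duggal_transform T)
              (((1 - l) * t) *\<^sub>R cadjoint (duggal_transform T) + (l * (1 - t)) *\<^sub>R cadjoint T) 0))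
       \<le> 2 * numerical_radius
            (op_matrix 0 (l *\<^sub>R T) ((1 - l) *\<^sub>R cadjoint (duggal_transform T)) 0)
     \<and> 2 * numerical_radius
            (op_matrix 0 (l *\<^sub>R T) ((1 - l) *\<^sub>R cadjoint (duggal_transform T)) 0)
       \<le> sqrt (norm (l\<^sup>2 *\<^sub>R (abs_op T o\<^sub>L abs_op T)
                    + (1 - l)\<^sup>2 *\<^sub>R (abs_op (duggal_transform T) o\<^sub>L abs_op (duggal_transform T)))
            + 2 * l * (1 - l) * numerical_radius (cadjoint T o\<^sub>L duggal_transform T))
     \<and> sqrt (norm (l\<^sup>2 *\<^sub>R (abs_op T o\<^sub>L abs_op T)
                    + (1 - l)\<^sup>2 *\<^sub>R (abs_op (duggal_transform T) o\<^sub>L abs_op (duggal_transform T)))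
            + 2 * l * (1 - l) * numerical_radius (cadjoint T o\<^sub>L duggal_transform T))
       \<le> l * norm T + (1 - l) * norm (duggal_transform T)"
proof -
  let ?D = "duggal_transform T"
  define A where "A = l *\<^sub>R T"
  define B where "B = (1 - l) *\<^sub>R ?D"
  have T: "clinear_op T" and D: "clinear_op ?D"
    using assms(1) by (simp_all add: clinear_op_duggal_transform)
  have A: "clinear_op A" and B: "clinear_op B"
    using T D by (simp_all add: A_def B_def clinear_op_scaleR)
  have A': "cadjoint A = l *\<^sub>R cadjoint T" and B': "cadjoint B = (1 - l) *\<^sub>R cadjoint ?D"
    using T D by (simp_all add: A_def B_def cadjoint_scaleR)
  have sum: "mean_transform l T = A + B"
    by (simp add: mean_transform_def A_def B_def)
  have scale: "(r * t) *\<^sub>R S = t *\<^sub>R r *\<^sub>R S" for r t and S :: "'a \<Rightarrow>\<^sub>L 'a"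
    by (simp add: mult.commute)
  have path: "op_matrix 0 ((l * t) *\<^sub>R T + ((1 - l) * (1 - t)) *\<^sub>R ?D)
      (((1 - l) * t) *\<^sub>R cadjoint ?D + (l * (1 - t)) *\<^sub>R cadjoint T) 0
    = op_matrix 0 (t *\<^sub>R A + (1 - t) *\<^sub>R B) (t *\<^sub>R cadjoint B + (1 - t) *\<^sub>R cadjoint A) 0" for t
    by (simp only: scale A' B') (simp only: A_def B_def)
  \<comment> \<open>The modulus enters only through its square, which is
    \<open>cadjoint S o\<^sub>L S\<close>; the squared coefficients are split between the two
    factors.\<close>
  have squares: "l\<^sup>2 *\<^sub>R (abs_op T o\<^sub>L abs_op T) + (1 - l)\<^sup>2 *\<^sub>R (abs_op ?D o\<^sub>L abs_op ?D)
      = (cadjoint A o\<^sub>L A) + (cadjoint B o\<^sub>L B)"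
    unfolding abs_op_squared[OF T] abs_op_squared[OF D] A' B'
    by (rule blinfun_eqI) (simp add: A_def B_def blinfun.bilinear_simps power2_eq_square)
  \<comment> \<open>For \<open>l\<close> between 0 and 1 the scalar \<open>l * (1 - l)\<close> is
    nonnegative and equals its absolute value.\<close>
  have "numerical_radius (cadjoint A o\<^sub>L B) = l * (1 - l) * numerical_radius (cadjoint T o\<^sub>L ?D)"
  proof -
    have "cadjoint A o\<^sub>L B = (l * (1 - l)) *\<^sub>R (cadjoint T o\<^sub>L ?D)"
      unfolding A' B_def by (rule blinfun_eqI) (simp add: blinfun.bilinear_simps mult.commute)
    then show ?thesis
      using assms by (simp add: numerical_radius_scaleR)
  qed
  then have cross: "2 * l * (1 - l) * numerical_radius (cadjoint T o\<^sub>L ?D)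
      = 2 * numerical_radius (cadjoint A o\<^sub>L B)"
    by simp
  have norms: "l * norm T + (1 - l) * norm ?D = norm A + norm B"
    using assms by (simp add: A_def B_def)
  show ?thesis
    unfolding path sum squares cross norms A_def[symmetric] B'[symmetric]
    using norm_add_le_integral_numerical_radius[OF A B] numerical_radius_off_diagonal_le[OF A B]
      sqrt_cadjoint_compose_le[OF A B]
    by linarith
qed

end
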